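(* If $G$ is a graph with $n(G)\ge 2$, then $$2\le \mathrm{gp}_{\mathrm g}(G) \le 2 + \max_{u\in V(G)} \min_{v\in N(u)} |{}_uW_v|.$$
   Context: $n(G)$ is the order (number of vertices) of $G$; $d_G(u,v)$ is the length of a shortest $u,v$-path in $G$; $N(u)$ is the set of neighbours of $u$. For an edge $uv\in E(G)$, ${}_uW_v=\{w\in V(G): d_G(u,w)=d_G(v,w)\}$. A set $S\subseteq V(G)$ is in general position if no shortest path of $G$ passes through more than two vertices of $S$. In the Builder-Blocker general position game on $G$, two players, Builder and Blocker, take it in turns to choose (mark) an unmarked vertex of $G$ so that at each stage the set of marked vertices is in general position; the game ends when no further vertex can be selected. Builder aims to make the final set of marked vertices as large as possible, Blocker as small as possible. In the B-game Builder moves first. $\mathrm{gp}_{\mathrm g}(G)$ is the number of vertices in the final set when the B-game is played optimally by both players. *)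

theory Defs
  imports "Graph_Theory.Arc_Walk" "HOL-Library.Extended_Nat"
begin

text \<open>
  A finite simple graph is the locale \<open>graph\<close>: a finite, loop-free, symmetric digraph without
  parallel arcs, so that an edge is a pair of opposite arcs. An \<open>apath\<close> is a walk without
  repeated vertices, given by its list of arcs.
\<close>

datatype player = Builder | Blocker

fun opponent :: "player \<Rightarrow> player" where
  "opponent Builder = Blocker"
| "opponent Blocker = Builder"

context graph
begin

definition nbhd :: "'a \<Rightarrow> 'a set" where
  "nbhd u = {v. u \<rightarrow>\<^bsub>G\<^esub> v}"

text \<open>Graphs need not be connected: the distance between different components is \<open>\<infinity>\<close>,
  the infimum of the empty set.\<close>

definition gdist :: "'a \<Rightarrow> 'a \<Rightarrow> enat" where
  "gdist u v = (INF p \<in> {p. apath u p v}. enat (length p))"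

definition shortest_path :: "'a \<Rightarrow> 'b awalk \<Rightarrow> 'a \<Rightarrow> bool" where
  "shortest_path u p v \<longleftrightarrow> apath u p v \<and> enat (length p) = gdist u v"

definition equidist :: "'a \<Rightarrow> 'a \<Rightarrow> 'a set" where
  "equidist u v = {w \<in> verts G. gdist u w = gdist v w}"

definition general_position :: "'a set \<Rightarrow> bool" where
  "general_position S \<longleftrightarrow> S \<subseteq> verts G \<and>
     (\<forall>u p v. shortest_path u p v \<longrightarrow> card (set (awalk_verts u p) \<inter> S) \<le> 2)"

definition moves :: "'a set \<Rightarrow> 'a set" where
  "moves S = {x \<in> verts G - S. general_position (insert x S)}"

text \<open>The number of marked vertices at the end of the game if the set \<open>S\<close> is already marked, the
  given player is to move, and both players play optimally from then on (backward induction).\<close>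

function game_value :: "player \<Rightarrow> 'a set \<Rightarrow> nat" where
  "game_value pl S =
    (if moves S = {} then card S
     else (case pl of
         Builder \<Rightarrow> Max ((\<lambda>x. game_value (opponent pl) (insert x S)) ` moves S)
       | Blocker \<Rightarrow> Min ((\<lambda>x. game_value (opponent pl) (insert x S)) ` moves S)))"
  by pat_completeness auto
termination
proof (relation "measure (\<lambda>(pl, S). card (verts G - S))", goal_cases)
  case (2 pl S x)
  then have "verts G - insert x S \<subset> verts G - S" by (auto simp: moves_def)
  then show ?case by (auto intro: psubset_card_mono)
next
  case (3 pl S x)
  then have "verts G - insert x S \<subset> verts G - S" by (auto simp: moves_def)
  then show ?case by (auto intro: psubset_card_mono)
qed simp

declare game_value.simps [simp del]

definition gp_g :: nat where
  "gp_g = game_value Builder {}"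

lemma finite_nbhd: "finite (nbhd u)"
proof (rule finite_subset)
  show "nbhd u \<subseteq> verts G"
    by (auto simp: nbhd_def arcs_ends_conv)
qed simp

text \<open>Maxima and minima of the numbers \<open>|equidist u v|\<close> can be taken in \<open>enat\<close>, with the convention that
  the minimum over the neighbours of an isolated vertex is \<open>\<infinity>\<close>. Without isolated vertices
  (in particular for connected graphs of order at least 2) this changes nothing.\<close>

lemma max_min_equidist_eq:
  assumes "verts G \<noteq> {}" and "\<And>u. u \<in> verts G \<Longrightarrow> nbhd u \<noteq> {}"
  shows "(SUP u \<in> verts G. INF v \<in> nbhd u. enat (card (equidist u v))) =
    enat (MAX u \<in> verts G. MIN v \<in> nbhd u. card (equidist u v))"
proof -
  have mono: "mono enat" by (simp add: mono_def)
  have "(INF v \<in> nbhd u. enat (card (equidist u v))) = enat (MIN v \<in> nbhd u. card (equidist u v))"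
    if "u \<in> verts G" for u
    using assms(2)[OF that] finite_nbhd
    by (simp add: mono_Min_commute[OF mono] image_image Min_Inf)
  then have "(SUP u \<in> verts G. INF v \<in> nbhd u. enat (card (equidist u v))) =
      (SUP u \<in> verts G. enat (MIN v \<in> nbhd u. card (equidist u v)))"
    by (intro SUP_cong) auto
  also have "\<dots> = enat (MAX u \<in> verts G. MIN v \<in> nbhd u. card (equidist u v))"
    using assms(1) by (simp add: mono_Max_commute[OF mono] image_image Max_Sup)
  finally show ?thesis .
qed

end

end

theory Submission
  imports Defs
begin

text \<open>
  Lower bound: any set of at most two vertices is in general position, so as long as fewer than
  two vertices are marked, every unmarked vertex is a legal move.

  Upper bound: if Builder opens with \<open>u\<close>, Blocker may answer with any neighbour \<open>v\<close> of \<open>u\<close>. A third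
  marked vertex \<open>w\<close> must then be equidistant from \<open>u\<close> and \<open>v\<close>: if \<open>w\<close> were closer to \<open>v\<close>, say, the
  edge \<open>uv\<close> followed by a shortest path from \<open>v\<close> to \<open>w\<close> would be a shortest path through the three
  marked vertices \<open>u\<close>, \<open>v\<close>, \<open>w\<close> (\<open>closer_end_excluded\<close>). So from the second move on the marked set
  stays inside \<open>{u, v} \<union> equidist u v\<close>, no matter how the two players continue. Blocker chooses
  \<open>v\<close> to minimise the size of this set; Builder can only choose \<open>u\<close>.

  The backward induction that defines the value of the game is unfolded only for the two opening
  moves. Beyond them it is enough that the value of a position is the size of some maximal
  general position set that contains it (\<open>game_value_eq_card_final\<close>).

  In a disconnected graph, a vertex \<open>w\<close> in another component than \<open>u\<close> and \<open>v\<close> has distance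
  \<open>\<infinity>\<close> from both, so it counts as equidistant; if \<open>u\<close> is isolated, the infimum over its
  neighbours is \<open>\<infinity>\<close>, and so is the bound.
\<close>

context graph
begin

lemma gdist_le_apath_length:
  assumes "apath u p v"
  shows "gdist u v \<le> enat (length p)"
  unfolding gdist_def using assms by (intro INF_lower) simp

lemma shortest_path_exists:
  assumes "gdist u v \<noteq> \<infinity>"
  obtains p where "shortest_path u p v"
proof -
  let ?L = "(\<lambda>p. enat (length p)) ` {p. apath u p v}"
  have "?L \<noteq> {}"
  proof
    assume "?L = {}"
    then have "gdist u v = Inf {}"
      by (simp only: gdist_def)
    then show False
      using assms by (simp add: Inf_enat_def)
  qed
  then obtain x where "x \<in> ?L"
    by blast
  then have "gdist u v \<in> ?L"
    unfolding gdist_def by (rule wellorder_InfI)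
  then show ?thesis
    using that by (auto simp: shortest_path_def)
qed

text \<open>
  The extended path still repeats no vertex: if \<open>p\<close> came back to the tail of \<open>e\<close>, its remainder would
  bring the tail at least as close to \<open>w\<close> as the head. It is shortest because the distances are
  integers, so the tail is at least one step further away than the head.
\<close>

lemma shortest_path_Cons:
  assumes e: "e \<in> arcs G" and p: "shortest_path (head G e) p w"
    and closer: "gdist (head G e) w < gdist (tail G e) w"
  shows "shortest_path (tail G e) (e # p) w"
proof -
  have walk: "awalk (head G e) p w" and len: "enat (length p) = gdist (head G e) w"
    using p by (auto simp: shortest_path_def apath_def)
  have "tail G e \<notin> set (awalk_verts (head G e) p)"
  proof
    assume "tail G e \<in> set (awalk_verts (head G e) p)"
    then obtain q r where qr: "p = q @ r" "awalk (head G e) q (tail G e)"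
      using awalk_decomp[OF walk] by blast
    then have "apath (tail G e) r w"
      using p apath_append_iff[of "head G e" q r w] by (auto simp: shortest_path_def)
    then have "gdist (tail G e) w \<le> enat (length r)"
      by (rule gdist_le_apath_length)
    also have "\<dots> \<le> enat (length p)"
      using qr(1) by simp
    finally have "gdist (tail G e) w \<le> enat (length p)" .
    then show False
      using closer len by simp
  qed
  then have path: "apath (tail G e) (e # p) w"
    using e p by (auto simp: shortest_path_def apath_Cons_iff)
  have "gdist (tail G e) w \<le> enat (length (e # p))"
    using path by (rule gdist_le_apath_length)
  moreover have "enat (length (e # p)) \<le> gdist (tail G e) w"
    using closer len by (metis eSuc_enat ileI1 length_Cons)
  ultimately show ?thesis
    using path by (simp add: shortest_path_def)
qed

text \<open>
  Going from \<open>u\<close> to \<open>w\<close> via \<open>v\<close> would be a shortest path, and it meets \<open>S\<close> three times.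
\<close>

lemma closer_end_excluded:
  assumes S: "general_position S" "u \<in> S" "v \<in> S" "w \<in> S"
    and uv: "u \<rightarrow>\<^bsub>G\<^esub> v" and "w \<noteq> u" "w \<noteq> v"
  shows "\<not> gdist v w < gdist u w"
proof
  assume closer: "gdist v w < gdist u w"
  obtain e where e: "e \<in> arcs G" "tail G e = u" "head G e = v"
    using uv by (auto simp: arcs_ends_conv)
  obtain p where p: "shortest_path v p w"
    using closer by (metis enat_ord_simps(6) shortest_path_exists)
  have sp: "shortest_path u (e # p) w"
    using shortest_path_Cons[of e p w] e p closer by simp
  have "u \<noteq> v"
    using closer by auto
  have walk: "awalk v p w"
    using p by (simp add: shortest_path_def apath_def)
  have "awlast v p \<in> set (awalk_verts v p)"
    by simp
  then have "w \<in> set (awalk_verts v p)"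
    using walk by (auto elim!: awalkE)
  then have "{u, v, w} \<subseteq> set (awalk_verts u (e # p)) \<inter> S"
    using S(2-4) e hd_in_awalk_verts(1)[OF walk] by simp
  then have "card {u, v, w} \<le> card (set (awalk_verts u (e # p)) \<inter> S)"
    by (intro card_mono) auto
  also have "\<dots> \<le> 2"
    using S(1) sp unfolding general_position_def by blast
  finally show False
    using \<open>u \<noteq> v\<close> \<open>w \<noteq> u\<close> \<open>w \<noteq> v\<close> by simp
qed

lemma general_position_subset_equidist:
  assumes S: "general_position S" "u \<in> S" "v \<in> S" and uv: "u \<rightarrow>\<^bsub>G\<^esub> v"
  shows "S \<subseteq> {u, v} \<union> equidist u v"
proof
  fix w assume w: "w \<in> S"
  have "v \<rightarrow>\<^bsub>G\<^esub> u"
    using arcs_ends_symmetric[OF sym_arcs uv] .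
  then have "gdist u w = gdist v w" if "w \<noteq> u" "w \<noteq> v"
    using closer_end_excluded[OF S w uv that]
      closer_end_excluded[OF S(1,3,2) w _ that(2,1)]
    by (simp add: antisym not_less)
  then show "w \<in> {u, v} \<union> equidist u v"
    using S(1) w by (auto simp: equidist_def general_position_def)
qed

lemma general_position_if_card_le_2:
  assumes "S \<subseteq> verts G" "card S \<le> 2"
  shows "general_position S"
proof -
  have "finite S"
    using assms(1) by (rule finite_subset) simp
  then have "card (A \<inter> S) \<le> 2" for A
    using assms(2) card_mono[of S "A \<inter> S"] by simp
  then show ?thesis
    using assms(1) by (simp add: general_position_def)
qed

lemma finite_moves: "finite (moves S)"
  by (simp add: moves_def)

text \<open>
  Optimal play is one particular play, and its value is the size of the set at which it stops.
  So a bound on the size of every final set that contains \<open>S\<close> bounds the value, whoever is to move.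
\<close>

lemma game_value_eq_card_final:
  assumes "general_position S"
  obtains T where "S \<subseteq> T" "general_position T" "moves T = {}" "game_value pl S = card T"
proof -
  have "\<exists>T. S \<subseteq> T \<and> general_position T \<and> moves T = {} \<and> game_value pl S = card T"
    using assms
  proof (induction pl S rule: game_value.induct)
    case (1 pl S)
    show ?case
    proof (cases "moves S = {}")
      case True
      then show ?thesis
        using "1.prems" by (auto simp: game_value.simps[of pl S])
    next
      case False
      let ?V = "(\<lambda>x. game_value (opponent pl) (insert x S)) ` moves S"
      have fin: "finite ?V" "?V \<noteq> {}"
        using False finite_moves by auto
      have "game_value pl S \<in> ?V"
      proof (cases pl)
        case Builder
        then have "game_value pl S = Max ?V"
          using False by (simp add: game_value.simps[of Builder S])
        then show ?thesis
          using Max_in[OF fin] by simp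
      next
        case Blocker
        then have "game_value pl S = Min ?V"
          using False by (simp add: game_value.simps[of Blocker S])
        then show ?thesis
          using Min_in[OF fin] by simp
      qed
      then obtain x where x: "x \<in> moves S"
        "game_value pl S = game_value (opponent pl) (insert x S)"
        by blast
      have "general_position (insert x S)"
        using x(1) by (simp add: moves_def)
      then have "\<exists>T. insert x S \<subseteq> T \<and> general_position T \<and> moves T = {} \<and>
          game_value (opponent pl) (insert x S) = card T"
        using "1.IH" False x(1) by (cases pl) auto
      then show ?thesis
        using x(2) by auto
    qed
  qed
  then show ?thesis
    using that by blast
qed

lemma game_value_Builder_attained:
  assumes "moves S \<noteq> {}"
  obtains x where "x \<in> moves S" "game_value Builder S = game_value Blocker (insert x S)"
proof -
  have "game_value Builder S \<in> (\<lambda>x. game_value Blocker (insert x S)) ` moves S"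
    using Max_in[of "(\<lambda>x. game_value Blocker (insert x S)) ` moves S"] assms finite_moves
    by (simp add: game_value.simps[of Builder S])
  then show ?thesis
    using that by blast
qed

lemma game_value_Blocker_le:
  assumes "x \<in> moves S"
  shows "game_value Blocker S \<le> game_value Builder (insert x S)"
  using assms finite_moves by (auto simp: game_value.simps[of Blocker S])

lemma moves_nonempty_if_card_lt_2:
  assumes "S \<subseteq> verts G" "card S < 2" "2 \<le> card (verts G)"
  shows "moves S \<noteq> {}"
proof -
  obtain x where x: "x \<in> verts G - S"
    using assms by (metis Diff_eq_empty_iff all_not_in_conv not_less subset_antisym)
  have "card (insert x S) \<le> 2"
    using assms(2) card_insert_le_m1[of 2 S x] by simp
  then have "general_position (insert x S)"
    using x assms(1) by (intro general_position_if_card_le_2) auto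
  then show ?thesis
    using x by (auto simp: moves_def)
qed

lemma gp_g_ge_2:
  assumes "2 \<le> card (verts G)"
  shows "2 \<le> gp_g"
proof -
  obtain T where T: "general_position T" "moves T = {}" "gp_g = card T"
    using game_value_eq_card_final[of "{}" Builder] general_position_if_card_le_2[of "{}"]
    by (auto simp: gp_g_def)
  then show ?thesis
    using moves_nonempty_if_card_lt_2[of T] assms
    by (cases "card T < 2") (auto simp: general_position_def)
qed

text \<open>
  Blocker's answer \<open>v\<close> need not be the best one: any neighbour of \<open>u\<close> gives a bound.
\<close>

lemma game_value_Blocker_le_equidist:
  assumes uv: "u \<rightarrow>\<^bsub>G\<^esub> v"
  shows "game_value Blocker {u} \<le> 2 + card (equidist u v)"
proof -
  have verts: "u \<in> verts G" "v \<in> verts G"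
    using uv by (auto simp: arcs_ends_conv)
  have neq: "v \<noteq> u"
    using uv adj_not_same by auto
  have gp: "general_position {v, u}"
    using verts neq by (intro general_position_if_card_le_2) auto
  then have move: "v \<in> moves {u}"
    using verts neq by (simp add: moves_def)
  obtain T where T: "{v, u} \<subseteq> T" "general_position T" "moves T = {}"
    "game_value Builder {v, u} = card T"
    using gp by (rule game_value_eq_card_final)
  have "finite (equidist u v)"
    by (simp add: equidist_def)
  then have "card T \<le> card ({u, v} \<union> equidist u v)"
    using T(1,2) general_position_subset_equidist[of T u v] uv by (intro card_mono) auto
  also have "\<dots> \<le> card {u, v} + card (equidist u v)"
    by (rule card_Un_le)
  also have "\<dots> = 2 + card (equidist u v)"
    using neq by simp
  finally show ?thesis
    using game_value_Blocker_le[OF move] T(4) by simp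
qed

lemma gp_g_le_equidist:
  assumes "2 \<le> card (verts G)"
  shows "enat gp_g \<le> 2 + (SUP u \<in> verts G. INF v \<in> nbhd u. enat (card (equidist u v)))"
proof -
  have "moves {} \<noteq> {}"
    using assms by (intro moves_nonempty_if_card_lt_2) auto
  then obtain u where u: "u \<in> moves {}" "gp_g = game_value Blocker {u}"
    unfolding gp_g_def by (rule game_value_Builder_attained)
  \<comment> \<open>In this form the left side is a lower bound for each term of the infimum, trivially so
    if \<open>u\<close> has no neighbours.\<close>
  have "enat gp_g - 2 \<le> (INF v \<in> nbhd u. enat (card (equidist u v)))"
  proof (rule INF_greatest)
    fix v assume "v \<in> nbhd u"
    then have "gp_g - 2 \<le> card (equidist u v)"
      using game_value_Blocker_le_equidist u(2) by (fastforce simp: nbhd_def)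
    then show "enat gp_g - 2 \<le> enat (card (equidist u v))"
      by (simp add: numeral_eq_enat)
  qed
  also have "\<dots> \<le> (SUP u \<in> verts G. INF v \<in> nbhd u. enat (card (equidist u v)))"
    using u(1) by (intro SUP_upper) (simp add: moves_def)
  finally have "2 + (enat gp_g - 2) \<le>
      2 + (SUP u \<in> verts G. INF v \<in> nbhd u. enat (card (equidist u v)))"
    by (rule add_left_mono)
  moreover have "2 + (enat gp_g - 2) = enat gp_g"
    using gp_g_ge_2[OF assms] by (simp add: numeral_eq_enat)
  ultimately show ?thesis
    by simp
qed

end

theorem theorem2p2:
  fixes G :: "('a, 'b) pre_digraph"
  assumes "graph G"
    and "card (verts G) \<ge> 2"
  shows "2 \<le> graph.gp_g G \<and>
    enat (graph.gp_g G) \<le>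
      2 + (SUP u \<in> verts G. INF v \<in> graph.nbhd G u. enat (card (graph.equidist G u v)))"
  using assms by (simp add: graph.gp_g_ge_2 graph.gp_g_le_equidist)

end
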